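(* Let $G=P_1\times\cdots\times P_t$ ($t\ge2$) be a finite nilpotent group, where $P_1,\dots,P_t$ are the Sylow subgroups of $G$ for the distinct prime divisors of $|G|$, such that none of the $P_i$ is abelian. Then $$\gamma_t\bigl(\mathcal{C}^{**}(G)\bigr)\le\min_{1\le i\le t}\gamma\bigl(\mathcal{C}^{**}(P_i)\bigr)+1.$$
   Context: For a finite group $G$ with center $Z(G)$, the proper commuting graph $\mathcal{C}^{**}(G)$ is the simple graph with vertex set $G\setminus Z(G)$ in which two distinct vertices $x,y$ are adjacent if and only if $xy=yx$. In a finite simple graph with vertex set $V$, a dominating set is a subset $X\subseteq V$ such that every vertex of $V\setminus X$ is adjacent to some vertex of $X$, and a total dominating set is a subset $S\subseteq V$ such that every $v\in V$ is adjacent to some $u\in S$; $\gamma$ and $\gamma_t$ denote the minimum cardinalities of a dominating set and of a total dominating set, respectively. *)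

theory Defs
  imports
    "HOL-Algebra.Algebra"
    "HOL-Library.Extended_Nat"
    "Graph_Theory.Pair_Digraph"
begin

definition group_center :: "('a, 'b) monoid_scheme \<Rightarrow> 'a set" where
  "group_center G = {z \<in> carrier G. \<forall>g \<in> carrier G. z \<otimes>\<^bsub>G\<^esub> g = g \<otimes>\<^bsub>G\<^esub> z}"

text \<open>
  The condition on commutators in the successor step says that the class of \<open>x\<close> is central modulo
  the previous term \<open>Z\<^sub>n\<close>, i.e. \<open>Z\<^sub>n\<^sub>+\<^sub>1 / Z\<^sub>n\<close> is the centre of \<open>G / Z\<^sub>n\<close>.
\<close>
primrec upper_central_series :: "('a, 'b) monoid_scheme \<Rightarrow> nat \<Rightarrow> 'a set" where
  "upper_central_series G 0 = {\<one>\<^bsub>G\<^esub>}"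
| "upper_central_series G (Suc n) =
    {x \<in> carrier G. \<forall>y \<in> carrier G.
       x \<otimes>\<^bsub>G\<^esub> y \<otimes>\<^bsub>G\<^esub> inv\<^bsub>G\<^esub> x \<otimes>\<^bsub>G\<^esub> inv\<^bsub>G\<^esub> y \<in> upper_central_series G n}"

definition nilpotent_group :: "('a, 'b) monoid_scheme \<Rightarrow> bool" where
  "nilpotent_group G \<longleftrightarrow> group G \<and> (\<exists>n. upper_central_series G n = carrier G)"

definition sylow_subgroup :: "('a, 'b) monoid_scheme \<Rightarrow> nat \<Rightarrow> 'a set \<Rightarrow> bool" where
  "sylow_subgroup G p P \<longleftrightarrow> subgroup P G \<and> card P = p ^ multiplicity p (order G)"

definition internal_direct_product ::
    "('a, 'b) monoid_scheme \<Rightarrow> 'i set \<Rightarrow> ('i \<Rightarrow> 'a set) \<Rightarrow> bool" where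
  "internal_direct_product G I P \<longleftrightarrow>
     (\<forall>i \<in> I. P i \<lhd> G) \<and>
     generate G (\<Union>i \<in> I. P i) = carrier G \<and>
     (\<forall>i \<in> I. P i \<inter> generate G (\<Union>j \<in> I - {i}. P j) = {\<one>\<^bsub>G\<^esub>})"

text \<open>
  Finite simple graphs are rendered as \<^locale>\<open>pair_graph\<close>s: finite, symmetric, loop-free digraphs
  without parallel arcs, in which the edge \<open>{x, y}\<close> is the pair of arcs \<open>(x, y)\<close> and \<open>(y, x)\<close>.
\<close>
definition proper_commuting_graph :: "('a, 'b) monoid_scheme \<Rightarrow> 'a pair_pre_digraph" where
  "proper_commuting_graph G =
     \<lparr> pverts = carrier G - group_center G,
       parcs = {(x, y). x \<in> carrier G - group_center G \<and> y \<in> carrier G - group_center G \<and>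
                        x \<noteq> y \<and> x \<otimes>\<^bsub>G\<^esub> y = y \<otimes>\<^bsub>G\<^esub> x} \<rparr>"

lemma pair_graph_proper_commuting_graph:
  assumes "finite (carrier G)"
  shows "pair_graph (proper_commuting_graph G)"
proof -
  have "finite {(x, y). x \<in> carrier G - group_center G \<and> y \<in> carrier G - group_center G \<and>
                        x \<noteq> y \<and> x \<otimes>\<^bsub>G\<^esub> y = y \<otimes>\<^bsub>G\<^esub> x}"
    by (rule finite_subset[of _ "carrier G \<times> carrier G"]) (use assms in auto)
  then show ?thesis
    using assms
    by unfold_locales
      (auto simp: proper_commuting_graph_def symmetric_def sym_def arcs_ends_conv with_proj_def)
qed

definition dominating_set :: "'a pair_pre_digraph \<Rightarrow> 'a set \<Rightarrow> bool" where
  "dominating_set H D \<longleftrightarrow>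
     D \<subseteq> pverts H \<and> (\<forall>v \<in> pverts H - D. \<exists>u \<in> D. (v, u) \<in> parcs H)"

definition total_dominating_set :: "'a pair_pre_digraph \<Rightarrow> 'a set \<Rightarrow> bool" where
  "total_dominating_set H S \<longleftrightarrow>
     S \<subseteq> pverts H \<and> (\<forall>v \<in> pverts H. \<exists>u \<in> S. (v, u) \<in> parcs H)"

text \<open>
  The two numbers below are meant for finite graphs. They take values in \<^typ>\<open>enat\<close> because a graph
  with an isolated vertex has no total dominating set: its total domination number is then \<open>\<infinity>\<close>
  (the infimum of the empty set), so that a finite upper bound also asserts existence. An infimum
  of a nonempty set in \<^typ>\<open>enat\<close> is attained, hence is a minimum.
\<close>
definition domination_number :: "'a pair_pre_digraph \<Rightarrow> enat" where
  "domination_number H = (INF D \<in> {D. dominating_set H D}. enat (card D))"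

definition total_domination_number :: "'a pair_pre_digraph \<Rightarrow> enat" where
  "total_domination_number H = (INF S \<in> {S. total_dominating_set H S}. enat (card S))"

end

theory Submission
  imports Defs
begin

text \<open>
  Fix a factor \<open>H = P\<^sub>i\<close>. The other factors centralise it, so every element of \<open>G\<close> has the form
  \<open>a c\<close> with \<open>a\<close> in \<open>H\<close> and \<open>c\<close> in the centraliser of \<open>H\<close>; and since there is another,
  non-abelian, factor, some \<open>k\<close> in the centraliser of \<open>H\<close> is not central in \<open>G\<close>.

  Let \<open>D\<close> dominate the proper commuting graph of \<open>H\<close>. Whether \<open>a\<close> is central in \<open>H\<close> or not, it
  commutes with some \<open>d\<close> in \<open>D\<close>, and then \<open>d\<close> commutes with \<open>a c\<close> because \<open>c\<close> centralises \<open>H\<close>.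
  This makes \<open>d\<close> a neighbour of \<open>a c\<close>, except when \<open>a c = d\<close>; but every element of \<open>D\<close> has
  the neighbour \<open>k\<close>. So \<open>D\<close> together with \<open>k\<close> is a total dominating set of the proper commuting
  graph of \<open>G\<close>. The argument is \<open>total_dominating_set_insert\<close>; it is applied to the factor with
  the smallest domination number.
\<close>

definition centralizer :: "('a, 'b) monoid_scheme \<Rightarrow> 'a set \<Rightarrow> 'a set" where
  "centralizer G H = {c \<in> carrier G. \<forall>h \<in> H. c \<otimes>\<^bsub>G\<^esub> h = h \<otimes>\<^bsub>G\<^esub> c}"

lemma (in group) subgroup_centralizer:
  assumes "H \<subseteq> carrier G"
  shows "subgroup (centralizer G H) G"
proof (rule subgroupI)
  show "centralizer G H \<subseteq> carrier G"
    by (auto simp: centralizer_def)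
  have "\<one> \<in> centralizer G H"
    using assms by (auto simp: centralizer_def)
  then show "centralizer G H \<noteq> {}"
    by blast
next
  fix x assume x: "x \<in> centralizer G H"
  have "inv x \<otimes> h = h \<otimes> inv x" if "h \<in> H" for h
  proof -
    have h: "h \<in> carrier G" "x \<in> carrier G" "x \<otimes> h = h \<otimes> x"
      using that assms x by (auto simp: centralizer_def)
    then have "x \<otimes> (h \<otimes> inv x) = h"
      by (simp add: m_assoc [symmetric]) (simp add: m_assoc)
    with h show ?thesis
      by (simp add: inv_solve_left')
  qed
  with x show "inv x \<in> centralizer G H"
    by (auto simp: centralizer_def)
next
  fix x y assume xy: "x \<in> centralizer G H" "y \<in> centralizer G H"
  have "x \<otimes> y \<otimes> h = h \<otimes> (x \<otimes> y)" if "h \<in> H" for h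
  proof -
    have "h \<in> carrier G" "x \<in> carrier G" "y \<in> carrier G"
      and "x \<otimes> h = h \<otimes> x" "y \<otimes> h = h \<otimes> y"
      using that assms xy by (auto simp: centralizer_def)
    then show ?thesis
      by (metis m_assoc)
  qed
  with xy show "x \<otimes> y \<in> centralizer G H"
    by (auto simp: centralizer_def)
qed

text \<open>
  The commutator \<open>x y x\<^sup>-\<^sup>1 y\<^sup>-\<^sup>1\<close> is a product of two elements of \<open>N\<close> and also a product of two
  elements of \<open>M\<close>, hence trivial.
\<close>

lemma (in group) normal_disjoint_subset_centralizer:
  assumes N: "N \<lhd> G" and M: "M \<lhd> G" and disj: "N \<inter> M = {\<one>}"
  shows "M \<subseteq> centralizer G N"
proof
  fix y assume y: "y \<in> M"
  interpret N: normal N G by (rule N)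
  interpret M: normal M G by (rule M)
  have yG: "y \<in> carrier G"
    using y M.subset by blast
  have "y \<otimes> x = x \<otimes> y" if x: "x \<in> N" for x
  proof -
    have xG: "x \<in> carrier G"
      using x N.subset by blast
    let ?c = "x \<otimes> y \<otimes> inv x \<otimes> inv y"
    have "?c \<in> M"
      using M.inv_op_closed2[OF xG y] y by simp
    moreover have "?c = x \<otimes> (y \<otimes> inv x \<otimes> inv y)"
      using xG yG by (simp add: m_assoc)
    then have "?c \<in> N"
      using N.inv_op_closed2[OF yG N.m_inv_closed[OF x]] x by simp
    ultimately have c1: "?c = \<one>"
      using disj by blast
    have "x \<otimes> y = ?c \<otimes> (y \<otimes> x)"
      using xG yG by (simp add: m_assoc inv_solve_left')
    with c1 show ?thesis
      using xG yG by simp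
  qed
  with yG show "y \<in> centralizer G N"
    by (simp add: centralizer_def)
qed

lemma (in group) internal_direct_product_subset_centralizer:
  assumes idp: "internal_direct_product G I P"
    and "i \<in> I" "j \<in> I" "j \<noteq> i"
  shows "P j \<subseteq> centralizer G (P i)"
proof (rule normal_disjoint_subset_centralizer)
  show N: "P i \<lhd> G" "P j \<lhd> G"
    using idp assms by (auto simp: internal_direct_product_def)
  have "P j \<subseteq> generate G (\<Union>l \<in> I - {i}. P l)"
    using assms by (auto intro: generate.incl)
  moreover have "P i \<inter> generate G (\<Union>l \<in> I - {i}. P l) = {\<one>}"
    using idp \<open>i \<in> I\<close> by (simp add: internal_direct_product_def)
  moreover have "\<one> \<in> P i" "\<one> \<in> P j"
    using N by (auto dest: normal_imp_subgroup subgroup.one_closed)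
  ultimately show "P i \<inter> P j = {\<one>}"
    by blast
qed

text \<open>The product of the normal subgroup \<open>P i\<close> and its centraliser is a subgroup containing all
  factors, which generate \<open>G\<close>.\<close>

lemma (in group) internal_direct_product_mult_centralizer:
  assumes idp: "internal_direct_product G I P" and i: "i \<in> I"
  shows "P i <#> centralizer G (P i) = carrier G"
proof
  let ?C = "centralizer G (P i)"
  have N: "P i \<lhd> G"
    using idp i by (simp add: internal_direct_product_def)
  then have sub: "subgroup (P i) G"
    by (rule normal_imp_subgroup)
  then have C: "subgroup ?C G"
    by (intro subgroup_centralizer subgroup.subset)
  have PC: "subgroup (P i <#> ?C) G"
    by (rule mult_norm_subgroup[OF N C])
  then show "P i <#> ?C \<subseteq> carrier G"
    by (rule subgroup.subset)
  have "P j \<subseteq> P i <#> ?C" if "j \<in> I" for j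
  proof
    fix x assume x: "x \<in> P j"
    have xG: "x \<in> carrier G"
      using x that idp by (auto simp: internal_direct_product_def
          dest!: normal_imp_subgroup subgroup.subset)
    show "x \<in> P i <#> ?C"
    proof (cases "j = i")
      case True
      then have "x \<otimes> \<one> \<in> P i <#> ?C"
        using x subgroup.one_closed[OF C] unfolding set_mult_def by blast
      with xG show ?thesis by simp
    next
      case False
      then have "x \<in> ?C"
        using internal_direct_product_subset_centralizer[OF idp i that] x by blast
      then have "\<one> \<otimes> x \<in> P i <#> ?C"
        using subgroup.one_closed[OF sub] unfolding set_mult_def by blast
      with xG show ?thesis by simp
    qed
  qed
  then have "generate G (\<Union>j \<in> I. P j) \<subseteq> P i <#> ?C"
    by (intro generate_subgroup_incl PC) blast
  then show "carrier G \<subseteq> P i <#> ?C"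
    using idp by (simp add: internal_direct_product_def)
qed

lemma (in group) non_comm_subgroup_center_psubset:
  assumes "subgroup H G" and "\<not> comm_group (G\<lparr>carrier := H\<rparr>)"
  shows "group_center (G\<lparr>carrier := H\<rparr>) \<subset> H"
proof -
  have "group (G\<lparr>carrier := H\<rparr>)"
    using assms(1) by (rule subgroup_imp_group)
  then have "\<exists>x \<in> H. \<exists>y \<in> H. x \<otimes> y \<noteq> y \<otimes> x"
    using assms(2) group.group_comm_groupI[of "G\<lparr>carrier := H\<rparr>"] by auto
  then show ?thesis
    by (auto simp: group_center_def)
qed

text \<open>
  An element of \<open>D\<close> may commute with no other element of \<open>D\<close>, and loops do not count; the
  element \<open>k\<close> is there for these. It lies outside \<open>D\<close> because it centralises \<open>H\<close>, while no
  vertex of the proper commuting graph of \<open>H\<close> does.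
\<close>

lemma total_dominating_set_insert:
  fixes G (structure)
  assumes "group G" and H: "H \<subseteq> carrier G"
    and G: "carrier G \<subseteq> H <#> centralizer G H"
    and non_comm: "group_center (G\<lparr>carrier := H\<rparr>) \<subset> H"
    and k: "k \<in> centralizer G H - group_center G"
    and D: "dominating_set (proper_commuting_graph (G\<lparr>carrier := H\<rparr>)) D"
  shows "total_dominating_set (proper_commuting_graph G) (insert k D)"
proof -
  interpret group G by fact
  let ?ZH = "group_center (G\<lparr>carrier := H\<rparr>)"
  have ZH: "?ZH = {z \<in> H. \<forall>h \<in> H. z \<otimes> h = h \<otimes> z}"
    by (simp add: group_center_def)
  have DH: "D \<subseteq> H - ?ZH"
    using D by (simp add: dominating_set_def proper_commuting_graph_def)
  have dom: "\<exists>d \<in> D. a \<otimes> d = d \<otimes> a" if "a \<in> H - ?ZH" for a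
    using D that by (cases "a \<in> D") (auto simp: dominating_set_def proper_commuting_graph_def)
  have "D \<noteq> {}"
    using dom non_comm by blast
  have DG: "d \<in> carrier G - group_center G" if "d \<in> D" for d
    using that DH H unfolding ZH by (auto simp: group_center_def)
  have D_centralizer: "d \<notin> centralizer G H" if "d \<in> D" for d
    using that DH unfolding ZH by (auto simp: centralizer_def)
  have kG: "k \<in> carrier G - group_center G"
    using k by (auto simp: centralizer_def)
  have "\<exists>u \<in> insert k D. u \<noteq> v \<and> v \<otimes> u = u \<otimes> v" if v: "v \<in> carrier G" for v
  proof (cases "v \<in> D")
    case True
    then have "k \<otimes> v = v \<otimes> k"
      using k DH by (auto simp: centralizer_def)
    moreover have "k \<noteq> v"
      using k D_centralizer True by blast
    ultimately show ?thesis
      by auto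
  next
    case False
    from v G obtain a c where a: "a \<in> H" and c: "c \<in> centralizer G H" and eq: "v = a \<otimes> c"
      unfolding set_mult_def by blast
    have "\<exists>d \<in> D. a \<otimes> d = d \<otimes> a"
    proof (cases "a \<in> ?ZH")
      case True
      with \<open>D \<noteq> {}\<close> DH show ?thesis
        unfolding ZH by blast
    next
      case False
      with a dom show ?thesis
        by blast
    qed
    then obtain d where d: "d \<in> D" "a \<otimes> d = d \<otimes> a"
      by blast
    have "c \<otimes> d = d \<otimes> c"
      using c d DH by (auto simp: centralizer_def)
    moreover have "a \<in> carrier G" "c \<in> carrier G" "d \<in> carrier G"
      using a c d DG H by (auto simp: centralizer_def)
    ultimately have "v \<otimes> d = d \<otimes> v"
      unfolding eq using d(2) by (metis m_assoc)
    with d(1) False show ?thesis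
      by (intro bexI[of _ d]) auto
  qed
  with kG DG show ?thesis
    unfolding total_dominating_set_def proper_commuting_graph_def by fastforce
qed

lemma total_domination_number_le_Suc_domination_number:
  assumes "\<And>D. dominating_set H D \<Longrightarrow> total_dominating_set K (insert k D)"
  shows "total_domination_number K \<le> domination_number H + 1"
proof (cases "\<exists>D. dominating_set H D")
  case True
  then have "domination_number H \<in> (\<lambda>D. enat (card D)) ` {D. dominating_set H D}"
    unfolding domination_number_def by (blast intro: wellorder_InfI)
  then obtain D where D: "dominating_set H D" "domination_number H = enat (card D)"
    by blast
  have "total_domination_number K \<le> enat (card (insert k D))"
    unfolding total_domination_number_def using assms[OF D(1)] by (intro INF_lower) simp
  also have "card (insert k D) \<le> card D + 1"
    by (cases "finite D") (auto simp: card_insert_if)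
  finally show ?thesis
    by (simp add: D(2) one_enat_def)
next
  case False
  \<comment> \<open>The infimum over no dominating sets is \<open>\<infinity>\<close>.\<close>
  then show ?thesis
    by (simp add: domination_number_def top_enat_def)
qed

theorem corollary5p2:
  fixes G :: "('a, 'b) monoid_scheme"
    and t :: nat
    and p :: "nat \<Rightarrow> nat"
    and P :: "nat \<Rightarrow> 'a set"
  assumes "group G"
    and "finite (carrier G)"
    and "nilpotent_group G"
    and "t \<ge> 2"
    and "bij_betw p {1..t} (prime_factors (order G))"
    and "\<And>i. i \<in> {1..t} \<Longrightarrow> sylow_subgroup G (p i) (P i)"
    and "internal_direct_product G {1..t} P"
    and "\<And>i. i \<in> {1..t} \<Longrightarrow> \<not> comm_group (G\<lparr>carrier := P i\<rparr>)"
  shows "total_domination_number (proper_commuting_graph G)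
           \<le> (MIN i \<in> {1..t}. domination_number (proper_commuting_graph (G\<lparr>carrier := P i\<rparr>))) + 1"
proof -
  interpret group G by fact
  note idp = assms(7)
  let ?\<gamma> = "\<lambda>i. domination_number (proper_commuting_graph (G\<lparr>carrier := P i\<rparr>))"
  have sub: "subgroup (P i) G" if "i \<in> {1..t}" for i
    using idp that by (auto simp: internal_direct_product_def intro: normal_imp_subgroup)
  have non_comm: "group_center (G\<lparr>carrier := P i\<rparr>) \<subset> P i" if "i \<in> {1..t}" for i
    by (rule non_comm_subgroup_center_psubset[OF sub[OF that] assms(8)[OF that]])
  have "Min (?\<gamma> ` {1..t}) \<in> ?\<gamma> ` {1..t}"
    using \<open>t \<ge> 2\<close> by (intro Min_in) auto
  then obtain i where i: "i \<in> {1..t}" and min: "Min (?\<gamma> ` {1..t}) = ?\<gamma> i"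
    by blast
  obtain j where j: "j \<in> {1..t}" "j \<noteq> i"
  proof
    show "(if i = 1 then 2 else 1) \<in> {1..t}" "(if i = 1 then 2 else 1) \<noteq> i"
      using \<open>t \<ge> 2\<close> by auto
  qed
  obtain k where k: "k \<in> P j" "k \<notin> group_center (G\<lparr>carrier := P j\<rparr>)"
    using non_comm[OF j(1)] by blast
  then have "k \<notin> group_center G"
    using subgroup.subset[OF sub[OF j(1)]] by (auto simp: group_center_def)
  moreover have "k \<in> centralizer G (P i)"
    using internal_direct_product_subset_centralizer[OF idp i j] k(1) by blast
  ultimately have "total_domination_number (proper_commuting_graph G) \<le> ?\<gamma> i + 1"
    using total_dominating_set_insert[OF is_group subgroup.subset[OF sub[OF i]] _ non_comm[OF i]]
      internal_direct_product_mult_centralizer[OF idp i]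
    by (intro total_domination_number_le_Suc_domination_number) blast
  then show ?thesis
    by (simp only: min)
qed

end
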